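(* Let $s\ge2$, $h$, $t$ be positive integers with $t\mid h$, and let $q=2^h$. Assume that $\mathbb{F}_q$ is the splitting field of $g(x)=x^{2^s}+\sum_{i=1}^{2^{s-1}-1}a_ix^{2^s-i}+c\in\mathbb{F}_{2^t}[x]$ with $c\ne0$ and $a_i\neq0$ for $1\le i\le2^{s-1}-1$, that $\alpha_1,\dots,\alpha_{2^s}$ are all the roots of $g(x)$ and are pairwise distinct, and let $v_i=\big(\sum_{j=1}^{2^{s-2}}a_{2j-1}^{2^{h-1}}\alpha_i^{2^{s-1}-j}\big)^{-1}$ for $1\le i\le2^s$. Let $\boldsymbol{\alpha}=(\alpha_1,\dots,\alpha_{2^s})$ and $\boldsymbol{v}=(v_1,\dots,v_{2^s})$. Let $\eta_{2^{s-1}}\in\mathbb{F}_q^*$ and $\eta_i=\eta_{2^{s-1}}a_{2^{s-1}-i}$ for $1\le i\le2^{s-1}-1$. Set $$\mathcal{S}_2=\Big\{\sum_{i=0}^{2^{s-1}-1}f_ix^i+f_0\,\eta_{2^{s-1}}\Big(\sum_{j=1}^{2^{s-1}-1}a_jx^{2^s-1-j}+x^{2^s-1}\Big): f_i\in\mathbb{F}_q\text{ for }0\le i\le2^{s-1}-1\Big\}.$$ Then $\mathcal{C}_2=ev_{\boldsymbol{\alpha},\boldsymbol{v}}(\mathcal{S}_2)$ is a $[2^s,\,2^{s-1}]$ self-dual TGRS code over $\mathbb{F}_q$.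
   Context: For $\boldsymbol{\alpha}\in\mathbb{F}^n$ with distinct entries and $\boldsymbol{v}\in(\mathbb{F}^* )^n$ ($\mathbb{F}$ a finite field), $ev_{\boldsymbol{\alpha},\boldsymbol{v}}(f)=(v_1f(\alpha_1),\dots,v_nf(\alpha_n))$ for $f\in\mathbb{F}[x]$. For a $k\times(n-k)$ matrix $(\eta_{ij})$ over $\mathbb{F}$, the twisted generalized Reed-Solomon (TGRS) code is the image under $ev_{\boldsymbol{\alpha},\boldsymbol{v}}$ of $\{\sum_{i=0}^{k-1}f_ix^i+\sum_{i=0}^{k-1}f_i\sum_{j=1}^{n-k}\eta_{i+1,j}x^{k-1+j}:f_i\in\mathbb{F}\}$. A linear code is $[n,k]$ if it has length $n$ and dimension $k$. It is self-dual if $\mathcal{C}=\mathcal{C}^\perp$ for the Euclidean inner product. *)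

theory Defs
  imports
    "HOL-Library.Cardinality"
    "HOL-Algebra.Generated_Fields"
    "Jordan_Normal_Form.VS_Connect"
begin

text \<open>
  Families such as \<open>\<alpha>\<close>, \<open>v\<close>, \<open>a\<close> and \<open>\<eta>\<close> are functions on \<open>nat\<close>, indexed from 1; only the
  indices in the stated ranges matter.  Code words are vectors of \<open>carrier_vec n\<close>, whose
  entries are indexed from 0, hence the shift by one in \<open>ev\<close>.
\<close>

definition ev :: "nat \<Rightarrow> (nat \<Rightarrow> 'a::field) \<Rightarrow> (nat \<Rightarrow> 'a) \<Rightarrow> 'a poly \<Rightarrow> 'a vec" where
  "ev n \<alpha> v f = vec n (\<lambda>i. v (i + 1) * poly f (\<alpha> (i + 1)))"

text \<open>\<open>\<eta> i j\<close> is the \<open>(i, j)\<close> entry of the \<open>k \<times> (n - k)\<close> twist matrix.\<close>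

definition tgrs_polys :: "nat \<Rightarrow> nat \<Rightarrow> (nat \<Rightarrow> nat \<Rightarrow> 'a::field) \<Rightarrow> 'a poly set" where
  "tgrs_polys n k \<eta> =
     {(\<Sum>i<k. monom (f i) i) +
      (\<Sum>i<k. Polynomial.smult (f i) (\<Sum>j = 1..n - k. monom (\<eta> (i + 1) j) (k - 1 + j))) | f. True}"

definition is_tgrs_code ::
    "nat \<Rightarrow> nat \<Rightarrow> (nat \<Rightarrow> 'a::field) \<Rightarrow> (nat \<Rightarrow> 'a) \<Rightarrow> 'a vec set \<Rightarrow> bool" where
  "is_tgrs_code n k \<alpha> v C \<longleftrightarrow>
     inj_on \<alpha> {1..n} \<and> (\<forall>i\<in>{1..n}. v i \<noteq> 0) \<and>
     (\<exists>\<eta>. C = ev n \<alpha> v ` tgrs_polys n k \<eta>)"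

definition is_linear_code :: "nat \<Rightarrow> nat \<Rightarrow> 'a::field vec set \<Rightarrow> bool" where
  "is_linear_code n k C \<longleftrightarrow>
     VectorSpace.subspace class_ring C (module_vec TYPE('a) n) \<and>
     vectorspace.dim class_ring ((module_vec TYPE('a) n)\<lparr>carrier := C\<rparr>) = k"

definition self_dual :: "nat \<Rightarrow> 'a::field vec set \<Rightarrow> bool" where
  "self_dual n C \<longleftrightarrow> C = vec_module.orthogonal_complement n C"

text \<open>The whole type \<open>'a\<close> is a splitting field of \<open>g\<close> over its subfield \<open>K\<close>.\<close>

definition is_splitting_field :: "'a::field set \<Rightarrow> 'a poly \<Rightarrow> bool" where
  "is_splitting_field K g \<longleftrightarrow>
     subfield K class_ring \<and> set (coeffs g) \<subseteq> K \<and>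
     (\<exists>A. g = Polynomial.smult (lead_coeff g) (\<Prod>r\<in>#A. [:- r, 1:])) \<and>
     generate_field class_ring (K \<union> {x. poly g x = 0}) = UNIV"

definition g_poly :: "nat \<Rightarrow> (nat \<Rightarrow> 'a::field) \<Rightarrow> 'a \<Rightarrow> 'a poly" where
  "g_poly s a c =
     monom 1 (2 ^ s) + (\<Sum>i = 1..2 ^ (s - 1) - 1. monom (a i) (2 ^ s - i)) + [:c:]"

text \<open>\<open>e\<close> stands for the twist coefficient with index \<open>2 ^ (s - 1)\<close>.\<close>

definition S2 :: "nat \<Rightarrow> (nat \<Rightarrow> 'a::field) \<Rightarrow> 'a \<Rightarrow> 'a poly set" where
  "S2 s a e =
     {(\<Sum>i = 0..2 ^ (s - 1) - 1. monom (f i) i) +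
      Polynomial.smult (f 0 * e)
        ((\<Sum>j = 1..2 ^ (s - 1) - 1. monom (a j) (2 ^ s - 1 - j)) + monom 1 (2 ^ s - 1)) | f. True}"

end

theory Submission
  imports Defs "Jordan_Normal_Form.DL_Rank"
begin

text \<open>
  Let \<open>n = 2k\<close> be the degree of \<open>g\<close>. In characteristic 2 the formula for \<open>v\<close> says exactly that
  \<open>v\<^sub>i\<^sup>2 = 1 / g' (\<alpha>\<^sub>i)\<close>, so by Lagrange interpolation \<open>\<Sum>\<^sub>i v\<^sub>i\<^sup>2 p (\<alpha>\<^sub>i) = 0\<close> whenever
  \<open>degree p \<le> n - 2\<close>. The twist is \<open>T = \<eta>\<^sub>k (g - c) / x\<close>, hence \<open>\<alpha>\<^sub>i T (\<alpha>\<^sub>i)\<close> does not depend on \<open>i\<close>,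
  and this makes every product of two message polynomials agree at the roots of \<open>g\<close> with a
  polynomial of degree at most \<open>n - 2\<close>: the code is self-orthogonal. As \<open>x\<^sup>k\<close> divides \<open>T\<close>, the
  polynomials \<open>x\<^sup>k, \<dots>, x\<^sup>2\<^sup>k\<^sup>-\<^sup>1\<close> span a complement of the code, so the dual code, like the code itself,
  has dimension \<open>k\<close>.
\<close>

section \<open>Frobenius and characteristic 2 in a finite field\<close>

text \<open>Multiplication by a nonzero \<open>x\<close> permutes the nonzero elements, so scaling
  every factor by \<open>x\<close> leaves their product unchanged.\<close>

lemma finite_field_power_CARD:
  fixes x :: "'a::{field, finite}"
  shows "x ^ CARD('a) = x"
proof (cases "x = 0")
  case False
  have "x * (\<Prod>y\<in>UNIV-{0}. x * y) = x * x ^ (CARD('a) - 1) * \<Prod>(UNIV-{0})"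
    by (simp add: prod.distrib mult_ac)
  also have "x * x ^ (CARD('a) - 1) = x ^ CARD('a)"
    by (metis power_eq_if zero_less_card_finite less_numeral_extra(3))
  also have "(\<Prod>y\<in>UNIV-{0}. x * y) = (\<Prod>y\<in>UNIV-{0}. y)"
    by (rule prod.reindex_bij_witness[of _ "\<lambda>y. y / x" "\<lambda>y. x * y"]) (use False in auto)
  finally show ?thesis
    by simp
qed simp

text \<open>The power \<open>2 ^ h\<close> fixes \<open>- 1\<close>, but being even it also sends
  \<open>- 1\<close> to 1.\<close>

lemma add_self_eq_0_if_CARD_power_2:
  fixes x :: "'a::{field, finite}"
  assumes "CARD('a) = 2 ^ h" and "h > 0"
  shows "x + x = 0"
proof -
  have "(- 1 :: 'a) ^ (2 ^ h) = - 1"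
    using finite_field_power_CARD[of "- 1 :: 'a"] assms(1) by simp
  moreover have "(- 1 :: 'a) ^ (2 ^ h) = 1"
    using assms(2) by simp
  ultimately have "(1 :: 'a) = - 1"
    by simp
  then have "(1 :: 'a) + 1 = 0"
    by (metis add.right_inverse)
  then show ?thesis
    by (metis distrib_left mult.right_neutral mult_zero_right)
qed

lemma sum_power2_char_2:
  fixes f :: "'b \<Rightarrow> 'a::comm_ring_1"
  assumes "\<And>x::'a. x + x = 0"
  shows "(\<Sum>i\<in>A. f i)\<^sup>2 = (\<Sum>i\<in>A. (f i)\<^sup>2)"
proof (induction A rule: infinite_finite_induct)
  case (insert a A)
  have "2 * f a * sum f A = 0"
    using assms[of "f a * sum f A"] by (simp add: algebra_simps mult_2)
  with insert show ?case
    by (simp add: power2_sum)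
qed simp_all

lemma finite_carrier_vec: "finite (carrier_vec n :: 'a::finite vec set)"
proof -
  have "carrier_vec n \<subseteq> vec_of_list ` {xs :: 'a list. set xs \<subseteq> UNIV \<and> length xs = n}"
  proof
    fix w :: "'a vec"
    assume "w \<in> carrier_vec n"
    then have "w = vec_of_list (list_of_vec w)" "length (list_of_vec w) = n"
      by (auto simp: vec_list)
    then show "w \<in> vec_of_list ` {xs. set xs \<subseteq> UNIV \<and> length xs = n}"
      by blast
  qed
  then show ?thesis
    by (rule finite_subset) (intro finite_imageI finite_lists_length_eq finite)
qed

subsection \<open>Sums over the roots of a separable polynomial\<close>

lemma smult_sum_right: "Polynomial.smult e (sum f I) = (\<Sum>i\<in>I. Polynomial.smult e (f i))"
  by (intro poly_eqI) (simp add: coeff_sum sum_distrib_left)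

lemma pCons_0_sum: "pCons 0 (sum f I) = (\<Sum>i\<in>I. pCons 0 (f i))"
proof (induction I rule: infinite_finite_induct)
  case (insert i I)
  then show ?case
    using add_pCons[of 0 "f i" 0 "sum f I"] by simp
qed simp_all

lemma pderiv_sum: "pderiv (sum f I) = (\<Sum>i\<in>I. pderiv (f i))"
  by (induction I rule: infinite_finite_induct) (simp_all add: pderiv_add)

lemma degree_prod_linear:
  fixes R :: "'a::field set"
  shows "degree (\<Prod>s\<in>R. [:- s, 1:]) = card R"
  by (subst degree_prod_sum_eq) auto

lemma coeff_prod_linear:
  fixes R :: "'a::field set"
  shows "coeff (\<Prod>s\<in>R. [:- s, 1:]) (card R) = 1"
  using lead_coeff_prod[of "\<lambda>s. [:- s, 1:]" R] by (simp add: degree_prod_linear)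

text \<open>The sum is the coefficient of degree \<open>card R - 1\<close> in the Lagrange
  interpolant of \<open>p\<close> on \<open>R\<close>. The interpolant is \<open>p\<close> itself,
  whose degree is too small for such a term.\<close>

lemma sum_div_prod_diff_eq_0:
  fixes R :: "'a::field set"
  assumes "finite R" and "degree p + 2 \<le> card R"
  shows "(\<Sum>r\<in>R. poly p r / (\<Prod>s\<in>R - {r}. r - s)) = 0"
proof -
  define \<omega> where "\<omega> r = poly p r / (\<Prod>s\<in>R - {r}. r - s)" for r
  define q where "q = (\<Sum>r\<in>R. Polynomial.smult (\<omega> r) (\<Prod>s\<in>R - {r}. [:- s, 1:]))"
  have "p = q"
  proof (rule poly_eqI_degree[of R])
    fix r assume r: "r \<in> R"
    have "poly q r = (\<Sum>t\<in>R. \<omega> t * (\<Prod>s\<in>R - {t}. r - s))"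
      by (simp add: q_def poly_sum poly_prod)
    also have "\<dots> = (\<Sum>t\<in>R. if t = r then poly p r else 0)"
    proof (rule sum.cong)
      fix t assume "t \<in> R"
      show "\<omega> t * (\<Prod>s\<in>R - {t}. r - s) = (if t = r then poly p r else 0)"
      proof (cases "t = r")
        case True
        then show ?thesis
          using assms(1) by (simp add: \<omega>_def)
      next
        case False
        then have "(\<Prod>s\<in>R - {t}. r - s) = 0"
          using assms(1) r by (intro prod_zero) auto
        with False show ?thesis
          by simp
      qed
    qed simp
    also have "\<dots> = poly p r"
      using assms(1) r by simp
    finally show "poly p r = poly q r" ..
  next
    show "degree p < card R"
      using assms(2) by simp
    have "degree q \<le> card R - 1"
      unfolding q_def
    proof (rule degree_sum_le[OF assms(1)])
      fix r assume "r \<in> R"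
      then show "degree (Polynomial.smult (\<omega> r) (\<Prod>s\<in>R - {r}. [:- s, 1:])) \<le> card R - 1"
        using degree_smult_le[of "\<omega> r" "\<Prod>s\<in>R - {r}. [:- s, 1:]"]
        by (simp add: degree_prod_linear)
    qed
    then show "degree q < card R"
      using assms(2) by simp
  qed
  then have "coeff q (card R - 1) = 0"
    using assms(2) by (simp add: coeff_eq_0 flip: \<open>p = q\<close>)
  moreover have "coeff (\<Prod>s\<in>R - {r}. [:- s, 1:]) (card R - 1) = 1" if "r \<in> R" for r
    using coeff_prod_linear[of "R - {r}"] that by simp
  ultimately show ?thesis
    by (simp add: q_def coeff_sum \<omega>_def)
qed

text \<open>Two monic polynomials of degree \<open>card R\<close> that agree on \<open>R\<close> are
  equal, as their difference has smaller degree.\<close>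

lemma monic_eq_prod_linear:
  fixes R :: "'a::field set"
  assumes "\<And>r. r \<in> R \<Longrightarrow> poly g r = 0" and "degree g = card R" and "lead_coeff g = 1"
  shows "g = (\<Prod>r\<in>R. [:- r, 1:])"
proof (cases "finite R")
  case True
  show ?thesis
  proof (rule poly_eqI_degree_lead_coeff[of _ "card R" _ R])
    fix z assume "z \<in> R"
    with True assms(1) show "poly g z = poly (\<Prod>r\<in>R. [:- r, 1:]) z"
      by (auto simp: poly_prod)
  qed (use assms in \<open>auto simp: coeff_prod_linear degree_prod_linear\<close>)
next
  \<comment> \<open>For infinite \<open>R\<close> both \<open>card R\<close> and the product take
    their default values 0 and 1.\<close>
  case False
  with assms have "degree g = 0" "lead_coeff g = 1"
    by auto
  then have "g = 1"
    by (metis degree_0_id of_nat_1 one_pCons)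
  with False show ?thesis
    by simp
qed

text \<open>In the product rule the term that keeps the factor of \<open>r\<close> vanishes at
  \<open>r\<close>. This identifies the Lagrange denominators with values of the derivative.\<close>

lemma poly_pderiv_prod_linear:
  fixes R :: "'a::field set"
  assumes "finite R" and "r \<in> R"
  shows "poly (pderiv (\<Prod>s\<in>R. [:- s, 1:])) r = (\<Prod>s\<in>R - {r}. r - s)"
proof -
  define q where "q = (\<Prod>s\<in>R - {r}. [:- s, 1:])"
  have "(\<Prod>s\<in>R. [:- s, 1:]) = [:- r, 1:] * q"
    unfolding q_def using assms by (rule prod.remove)
  then have "poly (pderiv (\<Prod>s\<in>R. [:- s, 1:])) r = poly q r"
    by (simp only: pderiv_mult) (simp add: pderiv_pCons)
  then show ?thesis
    by (simp add: q_def poly_prod)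
qed

subsection \<open>Linear codes\<close>

text \<open>The image is the column space of \<open>A\<close>, and a trivial kernel forces full
  column rank.\<close>

lemma is_linear_code_mult_mat_vec:
  fixes A :: "'a::field mat"
  assumes A: "A \<in> carrier_mat n k"
    and inj: "\<And>x. x \<in> carrier_vec k \<Longrightarrow> A *\<^sub>v x = 0\<^sub>v n \<Longrightarrow> x = 0\<^sub>v k"
  shows "is_linear_code n k ((*\<^sub>v) A ` carrier_vec k)"
proof -
  interpret vec_space "TYPE('a)" n .
  have cols: "set (cols A) \<subseteq> carrier_vec n"
    using A cols_dim by blast
  \<comment> \<open>Linear independence is stated for the set of columns, which hides repetitions.
    Two equal columns would put a difference of unit vectors into the kernel.\<close>
  have "distinct (cols A)"
  proof (rule ccontr)
    assume "\<not> distinct (cols A)"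
    then obtain i j where ij: "i < k" "j < k" "i \<noteq> j" "col A i = col A j"
      using A by (auto simp: distinct_conv_nth)
    have "A *\<^sub>v (unit_vec k i - unit_vec k j) = A *\<^sub>v unit_vec k i - A *\<^sub>v unit_vec k j"
      using A by (intro mult_minus_distrib_mat_vec) auto
    also have "\<dots> = col A i - col A j"
      using A ij(1,2) by (intro arg_cong2[of _ _ _ _ "(-)"] eq_vecI) (auto simp: scalar_prod_right_unit)
    also have "\<dots> = 0\<^sub>v n"
      using A ij(4) by (metis col_dim carrier_matD(1) minus_cancel_vec)
    finally have "unit_vec k i - unit_vec k j = (0\<^sub>v k :: 'a vec)"
      by (intro inj) auto
    then have "(unit_vec k i - unit_vec k j) $ i = (0\<^sub>v k :: 'a vec) $ i"
      by simp
    then show False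
      using ij by simp
  qed
  moreover from this have "lin_indpt (set (cols A))"
    using lin_depE[OF A] inj by metis
  ultimately have "rank A = k"
    by (rule lin_indpt_full_rank[OF A])
  moreover have "(*\<^sub>v) A ` carrier_vec k = span (set (cols A))"
    using col_space_eq[OF A] A unfolding col_space_def by auto
  ultimately show ?thesis
    using span_is_subspace[OF cols] by (simp add: is_linear_code_def rank_def)
qed

text \<open>The hypothesis on \<open>b\<close> makes the pairing with \<open>b 0, \<dots>, b (k - 1)\<close> injective on the orthogonal
  complement of \<open>C\<close>, which therefore has no more elements than \<open>C\<close>.\<close>

lemma self_dualI:
  fixes A :: "'a::{field, finite} mat"
  assumes A: "A \<in> carrier_mat n k"
    and inj: "\<And>x. x \<in> carrier_vec k \<Longrightarrow> A *\<^sub>v x = 0\<^sub>v n \<Longrightarrow> x = 0\<^sub>v k"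
    and C: "C = (*\<^sub>v) A ` carrier_vec k"
    and orth: "\<And>x y. x \<in> C \<Longrightarrow> y \<in> C \<Longrightarrow> x \<bullet> y = 0"
    and b: "\<And>i. b i \<in> carrier_vec n"
    and nondeg: "\<And>w. w \<in> vec_module.orthogonal_complement n C \<Longrightarrow>
                   (\<And>i. i < k \<Longrightarrow> w \<bullet> b i = 0) \<Longrightarrow> w = 0\<^sub>v n"
  shows "self_dual n C"
proof -
  let ?D = "vec_module.orthogonal_complement n C"
  have D: "w \<in> ?D \<longleftrightarrow> w \<in> carrier_vec n \<and> (\<forall>y\<in>C. w \<bullet> y = 0)" for w
    by (simp add: vec_module.orthogonal_complement_def)
  have Cn: "C \<subseteq> carrier_vec n"
    using A by (auto simp: C)
  have "inj_on ((*\<^sub>v) A) (carrier_vec k)"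
  proof (rule inj_onI)
    fix x y assume xy: "x \<in> carrier_vec k" "y \<in> carrier_vec k" "A *\<^sub>v x = A *\<^sub>v y"
    then have "A *\<^sub>v (x - y) = 0\<^sub>v n"
      using A by (simp add: mult_minus_distrib_mat_vec)
    with xy have "x - y = 0\<^sub>v k"
      by (intro inj) auto
    with xy show "x = y"
      by (metis carrier_vecD eq_vecI index_minus_vec(1) index_zero_vec(1) right_minus_eq)
  qed
  then have cardC: "card C = card (carrier_vec k :: 'a vec set)"
    by (simp add: C card_image)
  have "inj_on (\<lambda>w. vec k (\<lambda>i. w \<bullet> b i)) ?D"
  proof (rule inj_onI)
    fix w w' assume w: "w \<in> ?D" "w' \<in> ?D" and eq: "vec k (\<lambda>i. w \<bullet> b i) = vec k (\<lambda>i. w' \<bullet> b i)"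
    have wn: "w \<in> carrier_vec n" "w' \<in> carrier_vec n"
      using w D by auto
    have "w - w' \<in> ?D"
      using w Cn by (auto simp: D minus_scalar_prod_distrib[of _ n])
    moreover have "(w - w') \<bullet> b i = 0" if "i < k" for i
      using arg_cong[OF eq, of "\<lambda>u. u $ i"] that wn b
      by (simp add: minus_scalar_prod_distrib[of _ n])
    ultimately have "w - w' = 0\<^sub>v n"
      by (rule nondeg)
    with wn show "w = w'"
      by (metis carrier_vecD eq_vecI index_minus_vec(1) index_zero_vec(1) right_minus_eq)
  qed
  \<comment> \<open>Counting replaces a dimension formula for the dual: \<open>?D\<close> embeds
    into the vectors of length \<open>k\<close>, and \<open>C\<close> has exactly as many elements
    as there are such vectors.\<close>
  then have "card ?D \<le> card C"
    unfolding cardC by (rule card_inj_on_le) (auto simp: finite_carrier_vec)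
  moreover have "C \<subseteq> ?D"
    using Cn orth by (auto simp: D)
  moreover have "finite ?D"
    by (rule finite_subset[OF _ finite_carrier_vec[of n]]) (auto simp: D)
  ultimately show ?thesis
    unfolding self_dual_def by (metis card_seteq)
qed

section \<open>Evaluation vectors\<close>

lemma ev_carrier [simp]: "ev n \<alpha> v f \<in> carrier_vec n"
  by (simp add: ev_def)

lemma ev_add: "ev n \<alpha> v (p + q) = ev n \<alpha> v p + ev n \<alpha> v q"
  by (auto simp: ev_def algebra_simps)

text \<open>The nonzero multipliers can be cancelled, and then \<open>p\<close> has more roots than
  its degree allows.\<close>

lemma ev_eq_0_imp_eq_0:
  fixes \<alpha> v :: "nat \<Rightarrow> 'a::field"
  assumes "inj_on \<alpha> {1..n}" and "\<And>i. i \<in> {1..n} \<Longrightarrow> v i \<noteq> 0"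
    and "degree p < n" and "ev n \<alpha> v p = 0\<^sub>v n"
  shows "p = 0"
proof (rule poly_eqI_degree[of "\<alpha> ` {1..n}"])
  fix x assume "x \<in> \<alpha> ` {1..n}"
  then obtain i where i: "i \<in> {1..n}" "x = \<alpha> i"
    by blast
  have "ev n \<alpha> v p $ (i - 1) = 0"
    unfolding assms(4) using i by (intro index_zero_vec) auto
  moreover have "i - 1 < n" "Suc (i - 1) = i"
    using i by auto
  ultimately show "poly p x = poly 0 x"
    using i assms(2)[OF i(1)] by (simp add: ev_def)
qed (use assms in \<open>auto simp: card_image\<close>)

lemma scalar_prod_ev_ev:
  "ev n \<alpha> v p \<bullet> ev n \<alpha> v q = (\<Sum>i = 1..n. (v i)\<^sup>2 * (poly p (\<alpha> i) * poly q (\<alpha> i)))"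
proof -
  have "ev n \<alpha> v p \<bullet> ev n \<alpha> v q
      = (\<Sum>i<n. (v (Suc i))\<^sup>2 * (poly p (\<alpha> (Suc i)) * poly q (\<alpha> (Suc i))))"
    by (simp add: scalar_prod_def ev_def atLeast0LessThan power2_eq_square mult_ac)
  also have "\<dots> = (\<Sum>i = 1..n. (v i)\<^sup>2 * (poly p (\<alpha> i) * poly q (\<alpha> i)))"
    by (rule sum.reindex_bij_witness[of _ "\<lambda>i. i - 1" Suc]) auto
  finally show ?thesis .
qed

text \<open>The polynomial of degree \<open>n - 1\<close> that vanishes at all points but one
  isolates a single entry of \<open>w\<close>.\<close>

lemma orthogonal_to_ev_imp_eq_0:
  fixes \<alpha> v :: "nat \<Rightarrow> 'a::field"
  assumes "inj_on \<alpha> {1..n}" and "\<And>i. i \<in> {1..n} \<Longrightarrow> v i \<noteq> 0" and w: "w \<in> carrier_vec n"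
    and orth: "\<And>p. degree p < n \<Longrightarrow> w \<bullet> ev n \<alpha> v p = 0"
  shows "w = 0\<^sub>v n"
proof (rule eq_vecI)
  fix i assume "i < dim_vec (0\<^sub>v n :: 'a vec)"
  then have i: "i < n"
    by simp
  define R where "R = \<alpha> ` ({1..n} - {i + 1})"
  define p where "p = (\<Prod>r\<in>R. [:- r, 1:])"
  have "card R = n - 1"
    unfolding R_def using i assms(1) by (subst card_image) (auto simp: inj_on_diff)
  then have "degree p < n"
    using i by (simp add: p_def degree_prod_linear)
  then have "0 = w \<bullet> ev n \<alpha> v p"
    using orth by simp
  also have "\<dots> = (\<Sum>j<n. w $ j * (v (j + 1) * poly p (\<alpha> (j + 1))))"
    by (simp add: scalar_prod_def ev_def atLeast0LessThan)
  also have "\<dots> = (\<Sum>j<n. if j = i then w $ i * (v (i + 1) * poly p (\<alpha> (i + 1))) else 0)"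
    by (rule sum.cong) (auto simp: p_def R_def poly_prod)
  also have "\<dots> = w $ i * (v (i + 1) * poly p (\<alpha> (i + 1)))"
    using i by simp
  finally have "w $ i * (v (i + 1) * poly p (\<alpha> (i + 1))) = 0"
    by simp
  moreover have "poly p (\<alpha> (i + 1)) \<noteq> 0"
    using i inj_onD[OF assms(1), of "i + 1"] by (auto simp: p_def R_def poly_prod)
  moreover have "v (i + 1) \<noteq> 0"
    using i assms(2) by simp
  ultimately show "w $ i = 0\<^sub>v n $ i"
    using i by simp
qed (use w in auto)

subsection \<open>Codes with a twist in the constant coefficient\<close>

text \<open>The message polynomials of \<open>S2\<close>, with the twist left abstract. For positive
  \<open>k\<close> only the values of \<open>f\<close> below \<open>k\<close> matter.\<close>

definition twisted_poly :: "nat \<Rightarrow> 'a::field poly \<Rightarrow> (nat \<Rightarrow> 'a) \<Rightarrow> 'a poly" where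
  "twisted_poly k T f = (\<Sum>i<k. monom (f i) i) + Polynomial.smult (f 0) T"

lemma coeff_sum_monom:
  "coeff (\<Sum>i<k. monom (f i) i) m = (if m < k then f m else 0)"
  by (simp add: coeff_sum)

text \<open>A twist divisible by \<open>x^k\<close> leaves the low coefficients untouched, so the
  message can be read off from them.\<close>

lemma coeff_twisted_poly:
  assumes "\<And>m. m < k \<Longrightarrow> coeff T m = 0" and "m < k"
  shows "coeff (twisted_poly k T f) m = f m"
  using assms by (simp add: twisted_poly_def coeff_sum_monom)

lemma degree_sum_monom_le: "degree (\<Sum>i<k. monom (f i) i) \<le> k - 1"
  by (rule degree_le) (auto simp: coeff_sum_monom)

lemma degree_twisted_poly_less:
  assumes "degree T < 2 * k"
  shows "degree (twisted_poly k T f) < 2 * k"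
proof -
  have "degree (twisted_poly k T f) \<le> 2 * k - 1"
    unfolding twisted_poly_def
  proof (rule degree_add_le)
    show "degree (\<Sum>i<k. monom (f i) i) \<le> 2 * k - 1"
      using degree_sum_monom_le[of f k] by linarith
    show "degree (Polynomial.smult (f 0) T) \<le> 2 * k - 1"
      using degree_smult_le[of "f 0" T] assms by linarith
  qed
  with assms show ?thesis
    by linarith
qed

text \<open>In the factor \<open>F + f 0 T\<close> the value of \<open>T\<close> at \<open>x\<close> is \<open>d / x\<close>. The cross terms of the product
  vanish at \<open>0\<close> in characteristic 2, and \<open>x\<close> divides \<open>T\<close>, so all poles cancel.\<close>

lemma twisted_poly_mult:
  fixes T :: "'a::field poly"
  assumes char_2: "\<And>x::'a. x + x = 0" and "k > 0"
    and T: "coeff T 0 = 0" "degree T < 2 * k"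
    and root: "\<And>x. x \<in> R \<Longrightarrow> x * poly T x = d"
  obtains P where "degree P \<le> 2 * k - 2"
    and "\<And>x. x \<in> R \<Longrightarrow> poly (twisted_poly k T f) x * poly (twisted_poly k T g) x = poly P x"
proof -
  define F where "F = (\<Sum>i<k. monom (f i) i)"
  define G where "G = (\<Sum>i<k. monom (g i) i)"
  obtain F' where F': "F = pCons (f 0) F'"
    using assms(2) by (cases F) (auto simp: F_def dest!: arg_cong[of _ _ "\<lambda>p. coeff p 0"] simp: coeff_sum_monom)
  obtain G' where G': "G = pCons (g 0) G'"
    using assms(2) by (cases G) (auto simp: G_def dest!: arg_cong[of _ _ "\<lambda>p. coeff p 0"] simp: coeff_sum_monom)
  obtain M where M: "T = pCons 0 M"
    using T(1) by (cases T) auto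
  \<comment> \<open>On \<open>R\<close>, where \<open>x T = d\<close>, the product
    \<open>F T\<close> becomes \<open>f 0 T + d F'\<close>, similarly for \<open>G T\<close>, and
    \<open>T^2\<close> becomes \<open>d M\<close>. The two copies of \<open>f 0 g 0 T\<close>
    cancel, and what remains is \<open>P\<close>.\<close>
  define P where "P = F * G + (Polynomial.smult d (Polynomial.smult (g 0) F' + Polynomial.smult (f 0) G') + Polynomial.smult (f 0 * g 0 * d) M)"
  have deg: "degree F \<le> k - 1" "degree G \<le> k - 1"
    unfolding F_def G_def by (rule degree_sum_monom_le)+
  have "degree F' \<le> 2 * k - 2" "degree G' \<le> 2 * k - 2" "degree M \<le> 2 * k - 2"
    using deg T(2) by (auto simp: F' G' M split: if_splits)
  then have "degree P \<le> 2 * k - 2"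
    unfolding P_def using deg degree_mult_le[of F G]
    by (intro degree_add_le order.trans[OF degree_smult_le]) auto
  moreover have "poly (twisted_poly k T f) x * poly (twisted_poly k T g) x = poly P x"
    if "x \<in> R" for x
  proof -
    have d: "d = x * (x * poly M x)"
      using root[OF that] by (simp add: M)
    have "poly (twisted_poly k T f) x * poly (twisted_poly k T g) x
        = poly P x + (f 0 * g 0 * (x * poly M x) + f 0 * g 0 * (x * poly M x))"
      unfolding twisted_poly_def F_def[symmetric] G_def[symmetric]
      by (simp add: P_def F' G' M d algebra_simps)
    then show ?thesis
      by (simp add: char_2)
  qed
  ultimately show ?thesis
    using that by blast
qed

text \<open>Separates the coding theory from \<open>g\<close>: the twist enters through divisibility
  by \<open>x^k\<close>, its degree and the constancy of \<open>x T\<close> on the points, the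
  multipliers through \<open>orth\<close>.\<close>

lemma twisted_code:
  fixes \<alpha> v :: "nat \<Rightarrow> 'a::{field, finite}" and T :: "'a poly"
  assumes char_2: "\<And>x::'a. x + x = 0" and k: "k > 0"
    and inj: "inj_on \<alpha> {1..2 * k}" and v: "\<And>i. i \<in> {1..2 * k} \<Longrightarrow> v i \<noteq> 0"
    and T: "\<And>m. m < k \<Longrightarrow> coeff T m = 0" "degree T < 2 * k"
    and root: "\<And>i. i \<in> {1..2 * k} \<Longrightarrow> \<alpha> i * poly T (\<alpha> i) = d"
    and orth: "\<And>p. degree p \<le> 2 * k - 2 \<Longrightarrow> (\<Sum>i = 1..2 * k. (v i)\<^sup>2 * poly p (\<alpha> i)) = 0"
  shows "is_linear_code (2 * k) k (ev (2 * k) \<alpha> v ` range (twisted_poly k T)) \<and>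
         self_dual (2 * k) (ev (2 * k) \<alpha> v ` range (twisted_poly k T))"
proof -
  let ?n = "2 * k" and ?ev = "ev (2 * k) \<alpha> v" and ?P = "twisted_poly k T"
  define C where "C = ?ev ` range ?P"
  \<comment> \<open>A transposed generator matrix: column \<open>j\<close> evaluates
    \<open>x^j\<close>, and column 0 also carries the twist, because \<open>f 0\<close> multiplies
    \<open>T\<close>.\<close>
  define A where "A = mat ?n k (\<lambda>(i, j). v (i + 1) *
      (\<alpha> (i + 1) ^ j + (if j = 0 then poly T (\<alpha> (i + 1)) else 0)))"
  have A: "A \<in> carrier_mat ?n k"
    by (simp add: A_def)
  have Ax: "A *\<^sub>v x = ?ev (?P (\<lambda>i. x $ i))" if x: "x \<in> carrier_vec k" for x
  proof (rule eq_vecI)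
    fix i assume "i < dim_vec (?ev (?P (\<lambda>i. x $ i)))"
    then have i: "i < ?n"
      by (simp add: ev_def)
    let ?y = "\<alpha> (i + 1)"
    have "(A *\<^sub>v x) $ i
        = (\<Sum>j<k. v (i + 1) * (?y ^ j + (if j = 0 then poly T ?y else 0)) * x $ j)"
      using x i by (simp add: A_def mult_mat_vec_def scalar_prod_def atLeast0LessThan)
    also have "\<dots> = (\<Sum>j<k. v (i + 1) * (x $ j * ?y ^ j)
                        + (if j = 0 then v (i + 1) * (x $ 0 * poly T ?y) else 0))"
      by (rule sum.cong) (auto simp: algebra_simps)
    also have "\<dots> = v (i + 1) * ((\<Sum>j<k. x $ j * ?y ^ j) + x $ 0 * poly T ?y)"
      using k by (simp add: sum.distrib sum_distrib_left distrib_left)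
    also have "\<dots> = ?ev (?P (\<lambda>i. x $ i)) $ i"
      using i by (simp add: ev_def twisted_poly_def poly_sum poly_monom)
    finally show "(A *\<^sub>v x) $ i = ?ev (?P (\<lambda>i. x $ i)) $ i" .
  qed (simp add: A_def ev_def)
  have P_vec: "?P f = ?P (\<lambda>i. vec k f $ i)" for f
    using k by (simp add: twisted_poly_def)
  have C_eq: "C = (*\<^sub>v) A ` carrier_vec k"
  proof
    have "?ev (?P f) = A *\<^sub>v vec k f" for f
      using Ax[OF vec_carrier, of f] by (simp flip: P_vec)
    then show "C \<subseteq> (*\<^sub>v) A ` carrier_vec k"
      by (auto simp: C_def)
    show "(*\<^sub>v) A ` carrier_vec k \<subseteq> C"
      using Ax by (auto simp: C_def)
  qed
  have inj_A: "x = 0\<^sub>v k" if x: "x \<in> carrier_vec k" and 0: "A *\<^sub>v x = 0\<^sub>v ?n" for x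
  proof (rule eq_vecI)
    fix i assume "i < dim_vec (0\<^sub>v k :: 'a vec)"
    then have i: "i < k"
      by simp
    have "?P (\<lambda>i. x $ i) = 0"
      using 0 degree_twisted_poly_less[OF T(2)]
      by (intro ev_eq_0_imp_eq_0[OF inj v]) (auto simp: Ax[OF x])
    with i show "x $ i = 0\<^sub>v k $ i"
      using coeff_twisted_poly[OF T(1) i, of "\<lambda>i. x $ i"] by simp
  qed (use x in auto)
  have C_orth: "x \<bullet> y = 0" if xy: "x \<in> C" "y \<in> C" for x y
  proof -
    obtain f g where fg: "x = ?ev (?P f)" "y = ?ev (?P g)"
      using xy by (auto simp: C_def)
    obtain p where p: "degree p \<le> 2 * k - 2"
      "\<And>z. z \<in> \<alpha> ` {1..?n} \<Longrightarrow> poly (?P f) z * poly (?P g) z = poly p z"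
    proof (rule twisted_poly_mult[OF char_2 k T(1)[OF k] T(2), of "\<alpha> ` {1..?n}" d f g])
      show "z * poly T z = d" if "z \<in> \<alpha> ` {1..?n}" for z
        using root that by blast
    qed blast
    show ?thesis
      using orth[OF p(1)] p(2) by (simp add: fg scalar_prod_ev_ev)
  qed
  have nondeg: "w = 0\<^sub>v ?n"
    if w: "w \<in> vec_module.orthogonal_complement ?n C"
      and wb: "\<And>i. i < k \<Longrightarrow> w \<bullet> ?ev (monom 1 (k + i)) = 0" for w
  proof (rule orthogonal_to_ev_imp_eq_0[OF inj v])
    show wn: "w \<in> carrier_vec ?n"
      using w by (simp add: vec_module.orthogonal_complement_def)
    have add: "w \<bullet> ?ev (p + q) = w \<bullet> ?ev p + w \<bullet> ?ev q" for p q
      using wn by (simp add: ev_add scalar_prod_add_distrib[of _ ?n])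
    have zero: "w \<bullet> ?ev 0 = 0"
      using wn by (simp add: ev_def scalar_prod_def)
    have monom: "w \<bullet> ?ev (monom b (k + i)) = 0" if "i < k" for b i
    proof -
      have "w \<bullet> ?ev (monom b (k + i)) = b * (w \<bullet> ?ev (monom 1 (k + i)))"
        by (simp add: ev_def scalar_prod_def poly_monom sum_distrib_left mult_ac)
      with wb[OF that] show ?thesis
        by simp
    qed
    fix p :: "'a poly"
    assume p: "degree p < ?n"
    \<comment> \<open>Subtracting the message polynomial with the same low coefficients leaves a
      combination of \<open>x^k, ..., x^(2k-1)\<close>, to which \<open>wb\<close> applies.\<close>
    define q where "q = p - ?P (coeff p)"
    have q: "coeff q m = 0" if "m < k \<or> m \<ge> ?n" for m
      using that p degree_twisted_poly_less[OF T(2), of "coeff p"] coeff_twisted_poly[OF T(1)]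
      by (auto simp: q_def coeff_eq_0)
    have "q = (\<Sum>i<k. monom (coeff q (k + i)) (k + i))"
    proof (rule poly_eqI)
      fix m
      show "coeff q m = coeff (\<Sum>i<k. monom (coeff q (k + i)) (k + i)) m"
      proof (cases "m < k \<or> m \<ge> ?n")
        case True
        then show ?thesis
          using q by (auto simp: coeff_sum)
      next
        case False
        then have "(\<Sum>i<k. coeff (monom (coeff q (k + i)) (k + i)) m)
            = (\<Sum>i<k. if i = m - k then coeff q m else 0)"
          by (intro sum.cong) auto
        moreover from False have "m - k < k"
          by linarith
        ultimately show ?thesis
          by (simp add: coeff_sum del: coeff_monom)
      qed
    qed
    moreover have "w \<bullet> ?ev (\<Sum>i\<in>I. monom (coeff q (k + i)) (k + i)) = 0" if "I \<subseteq> {..<k}" for I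
      using finite_subset[OF that finite_lessThan] that
      by (induction I) (auto simp: zero add monom)
    ultimately have "w \<bullet> ?ev q = 0"
      by (metis order_refl)
    moreover have "w \<bullet> ?ev (?P (coeff p)) = 0"
      using w by (simp add: vec_module.orthogonal_complement_def C_def)
    ultimately show "w \<bullet> ?ev p = 0"
      using add[of q "?P (coeff p)"] by (simp add: q_def)
  qed
  have "self_dual ?n C"
    by (rule self_dualI[OF A inj_A C_eq C_orth ev_carrier nondeg])
  moreover have "is_linear_code ?n k C"
    unfolding C_eq by (rule is_linear_code_mult_mat_vec[OF A inj_A])
  ultimately show ?thesis
    by (simp add: C_def)
qed

subsection \<open>The twist obtained from \<open>g\<close>\<close>

text \<open>This is \<open>(g - c) / x\<close> for \<open>g\<close> of degree \<open>2 * k\<close>.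
  Its exponents run from \<open>k\<close> to \<open>2 * k - 1\<close>.\<close>

definition twist_poly :: "nat \<Rightarrow> (nat \<Rightarrow> 'a::field) \<Rightarrow> 'a poly" where
  "twist_poly k a = (\<Sum>j = 1..k - 1. monom (a j) (2 * k - 1 - j)) + monom 1 (2 * k - 1)"

lemma coeff_twist_poly_low:
  assumes "m < k"
  shows "coeff (twist_poly k a) m = 0"
  using assms by (auto simp: twist_poly_def coeff_sum intro!: sum.neutral)

lemma coeff_twist_poly_top:
  assumes "k > 0"
  shows "coeff (twist_poly k a) (2 * k - 1) = 1"
  using assms by (auto simp: twist_poly_def coeff_sum intro!: sum.neutral)

lemma degree_twist_poly:
  assumes "k > 0"
  shows "degree (twist_poly k a) = 2 * k - 1"
proof (rule antisym)
  show "degree (twist_poly k a) \<le> 2 * k - 1"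
    unfolding twist_poly_def
    by (intro degree_add_le degree_sum_le order.trans[OF degree_monom_le]) auto
  show "2 * k - 1 \<le> degree (twist_poly k a)"
    using coeff_twist_poly_top[OF assms, of a] by (intro le_degree) simp
qed

text \<open>At a root \<open>x\<close> of \<open>g\<close> this says that \<open>x\<close> times the
  twist is \<open>- c\<close>, the same value for all roots.\<close>

lemma g_poly_eq_pCons_twist_poly:
  assumes "s > 0"
  shows "g_poly s a c = pCons c (twist_poly (2 ^ (s - 1)) a)"
proof -
  define k :: nat where "k = 2 ^ (s - 1)"
  have n: "2 ^ s = 2 * k" "k > 0"
    using assms by (simp_all add: k_def flip: power_Suc)
  have "pCons 0 (twist_poly k a)
      = (\<Sum>j = 1..k - 1. pCons 0 (monom (a j) (2 * k - 1 - j))) + pCons 0 (monom 1 (2 * k - 1))"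
    by (simp add: twist_poly_def flip: pCons_0_sum)
  also have "\<dots> = (\<Sum>j = 1..k - 1. monom (a j) (2 * k - j)) + monom 1 (2 * k)"
    using n(2) by (intro arg_cong2[of _ _ _ _ "(+)"] sum.cong)
      (auto simp: Suc_diff_Suc simp flip: monom_Suc)
  finally have "g_poly s a c = pCons 0 (twist_poly k a) + [:c:]"
    unfolding g_poly_def n k_def[symmetric] by (simp add: add.commute)
  also have "\<dots> = pCons c (twist_poly k a)"
    by simp
  finally show ?thesis
    by (simp add: k_def)
qed

lemma S2_eq_range_twisted_poly:
  assumes "s > 0"
  shows "S2 s a e = range (twisted_poly (2 ^ (s - 1)) (Polynomial.smult e (twist_poly (2 ^ (s - 1)) a)))"
proof -
  have "(2::nat) ^ s = 2 * 2 ^ (s - 1)" "{0..2 ^ (s - 1) - 1} = {..<2 ^ (s - 1) :: nat}"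
    using assms by (simp flip: power_Suc)
      (metis Suc_pred' atLeast0AtMost lessThan_Suc_atMost pos2 zero_less_power)
  then show ?thesis
    by (simp add: S2_def twisted_poly_def twist_poly_def full_SetCompr_eq)
qed

text \<open>In characteristic 2 only the exponents \<open>4 m - i\<close> with odd \<open>i\<close> survive in the derivative, and
  these leave even exponents, so that the derivative is a square.\<close>

lemma poly_pderiv_pCons_twist_poly:
  fixes a b :: "nat \<Rightarrow> 'a::field"
  assumes char_2: "\<And>x::'a. x + x = 0" and "m > 0"
    and b: "\<And>j. (b j)\<^sup>2 = a (2 * j - 1)"
  shows "poly (pderiv (pCons c (twist_poly (2 * m) a))) x = (\<Sum>j = 1..m. b j * x ^ (2 * m - j))\<^sup>2"
proof -
  have two: "(2 :: 'a) = 0"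
    using char_2[of 1] by simp
  have of_nat: "of_nat i = (if odd i then 1 else (0 :: 'a))" for i
    by (induction i) (auto simp: two)
  have "pderiv (pCons c (twist_poly (2 * m) a))
      = pderiv (pCons 0 (twist_poly (2 * m) a))"
    by (simp add: pderiv_pCons)
  also have "pCons 0 (twist_poly (2 * m) a)
      = (\<Sum>i = 1..2 * m - 1. monom (a i) (4 * m - i)) + monom 1 (4 * m)"
  proof -
    have "pCons 0 (twist_poly (2 * m) a)
        = (\<Sum>i = 1..2 * m - 1. pCons 0 (monom (a i) (4 * m - 1 - i))) + pCons 0 (monom 1 (4 * m - 1))"
      by (simp add: twist_poly_def flip: pCons_0_sum)
    also have "\<dots> = (\<Sum>i = 1..2 * m - 1. monom (a i) (4 * m - i)) + monom 1 (4 * m)"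
      using assms(2) by (intro arg_cong2[of _ _ _ _ "(+)"] sum.cong)
        (auto simp: Suc_diff_Suc simp flip: monom_Suc)
    finally show ?thesis .
  qed
  \<comment> \<open>The leading monomial has even exponent \<open>4 * m\<close>, so its derivative
    is 0.\<close>
  finally have "poly (pderiv (pCons c (twist_poly (2 * m) a))) x
      = (\<Sum>i = 1..2 * m - 1. of_nat (4 * m - i) * a i * x ^ (4 * m - i - 1))"
    by (simp add: pderiv_add pderiv_sum pderiv_monom poly_sum poly_monom of_nat)
  also have "\<dots> = (\<Sum>i \<in> {i \<in> {1..2 * m - 1}. odd i}. a i * x ^ (4 * m - i - 1))"
    by (rule sum.mono_neutral_cong_right) (auto simp: of_nat)
  \<comment> \<open>With \<open>i = 2 * j - 1\<close> the exponent \<open>4 * m - i - 1\<close> is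
    twice \<open>2 * m - j\<close>, and \<open>b j\<close> is a square root of the
    coefficient.\<close>
  also have "\<dots> = (\<Sum>j = 1..m. (b j * x ^ (2 * m - j))\<^sup>2)"
    by (rule sum.reindex_bij_witness[of _ "\<lambda>j. 2 * j - 1" "\<lambda>i. (i + 1) div 2"])
      (auto simp: power_mult_distrib b diff_mult_distrib2 mult.commute[of _ 2] elim!: oddE simp flip: power_mult)
  also have "\<dots> = (\<Sum>j = 1..m. b j * x ^ (2 * m - j))\<^sup>2"
    by (rule sum_power2_char_2[OF char_2, symmetric])
  finally show ?thesis .
qed

lemma is_tgrs_code_twist_poly:
  fixes a :: "nat \<Rightarrow> 'a::field"
  assumes "k > 0"
    and "inj_on \<alpha> {1..2 * k}" and "\<And>i. i \<in> {1..2 * k} \<Longrightarrow> v i \<noteq> 0"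
  shows "is_tgrs_code (2 * k) k \<alpha> v (ev (2 * k) \<alpha> v ` range (twisted_poly k (Polynomial.smult e (twist_poly k a))))"
proof -
  \<comment> \<open>Only \<open>f 0\<close> is twisted, so only the first row is nonzero. The index
    is reversed since \<open>k - 1 + j = 2 * k - 1 - (k - j)\<close>.\<close>
  define \<eta> where "\<eta> i j = (if i = (1::nat) then if j = k then e else e * a (k - j) else 0)" for i j
  have twist: "(\<Sum>j = 1..k. monom (\<eta> 1 j) (k - 1 + j)) = Polynomial.smult e (twist_poly k a)"
  proof -
    have "(\<Sum>j = 1..k. monom (\<eta> 1 j) (k - 1 + j))
        = (\<Sum>j = 1..k - 1. monom (\<eta> 1 j) (k - 1 + j)) + monom (\<eta> 1 k) (k - 1 + k)"
      using assms(1) by (cases k) auto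
    also have "(\<Sum>j = 1..k - 1. monom (\<eta> 1 j) (k - 1 + j))
        = (\<Sum>j = 1..k - 1. Polynomial.smult e (monom (a j) (2 * k - 1 - j)))"
      by (rule sum.reindex_bij_witness[of _ "\<lambda>j. k - j" "\<lambda>j. k - j"])
        (auto simp: \<eta>_def smult_monom)
    also have "\<dots> + monom (\<eta> 1 k) (k - 1 + k) = Polynomial.smult e (twist_poly k a)"
      using assms(1)
      by (simp add: \<eta>_def twist_poly_def smult_add_right smult_sum_right smult_monom mult_2)
    finally show ?thesis .
  qed
  have "(\<Sum>i<k. Polynomial.smult (f i) (\<Sum>j = 1..2 * k - k. monom (\<eta> (i + 1) j) (k - 1 + j)))
      = Polynomial.smult (f 0) (Polynomial.smult e (twist_poly k a))" for f
  proof -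
    have "(\<Sum>i<k. Polynomial.smult (f i) (\<Sum>j = 1..2 * k - k. monom (\<eta> (i + 1) j) (k - 1 + j)))
        = (\<Sum>i<k. if i = 0 then Polynomial.smult (f 0) (\<Sum>j = 1..k. monom (\<eta> 1 j) (k - 1 + j)) else 0)"
      by (rule sum.cong) (auto simp: \<eta>_def)
    with assms(1) show ?thesis
      unfolding twist by simp
  qed
  then have "tgrs_polys (2 * k) k \<eta> = range (twisted_poly k (Polynomial.smult e (twist_poly k a)))"
    by (auto simp: tgrs_polys_def twisted_poly_def)
  with assms(2,3) show ?thesis
    unfolding is_tgrs_code_def by metis
qed

section \<open>The roots of \<open>g_poly\<close> as evaluation points\<close>

theorem theorem25:
  fixes s h t :: nat
    and K :: "'a::{field, finite} set"
    and a \<alpha> v \<eta> :: "nat \<Rightarrow> 'a"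
    and c :: 'a
  assumes "s \<ge> 2" and "h > 0" and "t > 0" and "t dvd h"
    and "CARD('a) = 2 ^ h"
    and "subfield K class_ring" and "card K = 2 ^ t"
    and "set (coeffs (g_poly s a c)) \<subseteq> K"
    and "is_splitting_field K (g_poly s a c)"
    and "c \<noteq> 0"
    and "\<forall>i\<in>{1..2 ^ (s - 1) - 1}. a i \<noteq> 0"
    and "\<alpha> ` {1..2 ^ s} = {x. poly (g_poly s a c) x = 0}"
    and "inj_on \<alpha> {1..2 ^ s}"
    and "\<forall>i\<in>{1..2 ^ s}. v i =
           inverse (\<Sum>j = 1..2 ^ (s - 2). a (2 * j - 1) ^ (2 ^ (h - 1)) * \<alpha> i ^ (2 ^ (s - 1) - j))"
    and "\<eta> (2 ^ (s - 1)) \<noteq> 0"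
    and "\<forall>i\<in>{1..2 ^ (s - 1) - 1}. \<eta> i = \<eta> (2 ^ (s - 1)) * a (2 ^ (s - 1) - i)"
  shows "is_linear_code (2 ^ s) (2 ^ (s - 1)) (ev (2 ^ s) \<alpha> v ` S2 s a (\<eta> (2 ^ (s - 1))))
       \<and> self_dual (2 ^ s) (ev (2 ^ s) \<alpha> v ` S2 s a (\<eta> (2 ^ (s - 1))))
       \<and> is_tgrs_code (2 ^ s) (2 ^ (s - 1)) \<alpha> v (ev (2 ^ s) \<alpha> v ` S2 s a (\<eta> (2 ^ (s - 1))))"
proof -
  define k :: nat where "k = 2 ^ (s - 1)"
  define m :: nat where "m = 2 ^ (s - 2)"
  define e where "e = \<eta> (2 ^ (s - 1))"
  define L where "L = twist_poly k a"
  \<comment> \<open>Since the power \<open>2 ^ h\<close> is the identity on the field, the power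
    \<open>2 ^ (h - 1)\<close> extracts square roots.\<close>
  define b where "b j = a (2 * j - 1) ^ 2 ^ (h - 1)" for j
  define R where "R = \<alpha> ` {1..2 * k}"
  let ?g = "g_poly s a c"
  obtain r where r: "s = 2 + r"
    using assms(1) le_Suc_ex by blast
  then have km: "k = 2 * m" "2 ^ s = 2 * k" "k > 0" "m > 0"
    by (simp_all add: k_def m_def)
  have char_2: "x + x = 0" for x :: 'a
    using add_self_eq_0_if_CARD_power_2 assms(2,5) by blast
  have b: "(b j)\<^sup>2 = a (2 * j - 1)" for j
  proof -
    have "(b j)\<^sup>2 = a (2 * j - 1) ^ CARD('a)"
      using assms(2,5) by (cases h) (simp_all add: b_def mult_ac flip: power_mult)
    then show ?thesis
      by (simp add: finite_field_power_CARD)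
  qed
  have g: "?g = pCons c L"
    using assms(1) by (simp add: g_poly_eq_pCons_twist_poly L_def k_def)
  have L: "\<And>i. i < k \<Longrightarrow> coeff L i = 0" "degree L = 2 * k - 1" "coeff L (2 * k - 1) = 1"
    using km(3) coeff_twist_poly_low degree_twist_poly coeff_twist_poly_top
    unfolding L_def by blast+
  have inj: "inj_on \<alpha> {1..2 * k}"
    using assms(13) by (simp add: km(2))
  have R: "R = {x. poly ?g x = 0}" "finite R" "card R = 2 * k"
    using assms(12) card_image[OF inj] by (simp_all add: R_def km(2))
  \<comment> \<open>The \<open>2 * k\<close> distinct points exhaust the degree of \<open>g\<close>,
    so all its roots are simple.\<close>
  have "?g = (\<Prod>r\<in>R. [:- r, 1:])"
  proof (rule monic_eq_prod_linear)
    show "degree ?g = card R"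
      using L km by (auto simp: g R(3))
    show "lead_coeff ?g = 1"
      unfolding g using L(2,3) lead_coeff_pCons(1)[of L c] by fastforce
  qed (use R(1) in auto)
  then have pderiv_g: "poly (pderiv ?g) r = (\<Prod>t\<in>R - {r}. r - t)" if "r \<in> R" for r
    using poly_pderiv_prod_linear[OF R(2) that] by simp
  have v: "(v i)\<^sup>2 = 1 / (\<Prod>t\<in>R - {\<alpha> i}. \<alpha> i - t)" if i: "i \<in> {1..2 * k}" for i
  proof -
    have "v i = inverse (\<Sum>j = 1..m. b j * \<alpha> i ^ (2 * m - j))"
      using assms(14) i unfolding b_def km(1)[symmetric] by (simp add: k_def m_def km(2))
    then have "(v i)\<^sup>2 = inverse (poly (pderiv ?g) (\<alpha> i))"
      using poly_pderiv_pCons_twist_poly[of m b a c "\<alpha> i", OF char_2 km(4) b]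
      by (simp add: g L_def km(1) power_inverse)
    also have "\<dots> = 1 / (\<Prod>t\<in>R - {\<alpha> i}. \<alpha> i - t)"
      using i by (subst pderiv_g) (auto simp: R_def divide_inverse)
    finally show ?thesis .
  qed
  \<comment> \<open>As \<open>inverse 0 = 0\<close>, this needs proof: the square of
    \<open>v i\<close> is the inverse of a product of nonzero differences of roots.\<close>
  have v_nz: "v i \<noteq> 0" if i: "i \<in> {1..2 * k}" for i
  proof -
    have "(v i)\<^sup>2 \<noteq> 0"
      using R(2) by (auto simp: v[OF i])
    then show ?thesis
      by auto
  qed
  have orth: "(\<Sum>i = 1..2 * k. (v i)\<^sup>2 * poly p (\<alpha> i)) = 0" if "degree p \<le> 2 * k - 2" for p
  proof -
    have "(\<Sum>i = 1..2 * k. (v i)\<^sup>2 * poly p (\<alpha> i))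
        = (\<Sum>i = 1..2 * k. poly p (\<alpha> i) / (\<Prod>t\<in>R - {\<alpha> i}. \<alpha> i - t))"
      by (rule sum.cong) (auto simp: v)
    also have "\<dots> = (\<Sum>r\<in>R. poly p r / (\<Prod>t\<in>R - {r}. r - t))"
      unfolding R_def by (subst sum.reindex[OF inj]) simp
    also have "\<dots> = 0"
      using that km R by (intro sum_div_prod_diff_eq_0) auto
    finally show ?thesis .
  qed
  have root: "\<alpha> i * poly (Polynomial.smult e L) (\<alpha> i) = - (e * c)" if "i \<in> {1..2 * k}" for i
  proof -
    have "c + \<alpha> i * poly L (\<alpha> i) = 0"
      using that R(1) by (auto simp: R_def g)
    then have "\<alpha> i * poly L (\<alpha> i) = - c"
      by (simp add: eq_neg_iff_add_eq_0 add.commute)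
    then show ?thesis
      by (metis mult.left_commute mult_minus_right poly_smult)
  qed
  have "degree (Polynomial.smult e L) < 2 * k"
    using L(2) km(3) degree_smult_le[of e L] by linarith
  then have "is_linear_code (2 * k) k (ev (2 * k) \<alpha> v ` range (twisted_poly k (Polynomial.smult e L))) \<and>
      self_dual (2 * k) (ev (2 * k) \<alpha> v ` range (twisted_poly k (Polynomial.smult e L)))"
    using L(1) by (intro twisted_code[OF char_2 km(3) inj v_nz _ _ root orth]) simp_all
  moreover have "S2 s a e = range (twisted_poly k (Polynomial.smult e L))"
    using assms(1) by (simp add: S2_eq_range_twisted_poly L_def k_def)
  ultimately show ?thesis
    using is_tgrs_code_twist_poly[of k \<alpha> v e a, OF km(3) inj v_nz]
    unfolding e_def[symmetric] unfolding km(2) k_def[symmetric] L_def by simp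
qed

end
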